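(* Let $\alpha\ge0$. Then for every $m>1$ there exists a constant $C_{\alpha,m}$ such that for all $f\in L^2(\mathbb{R})$, $$\mathcal{G}_{\alpha,m}f(x)\le C_{\alpha,m}\,S_\alpha f(x),\qquad x\in\mathbb{R}.$$
   Context: For $f\in L^2(\mathbb{R})$, $m\in\mathbb{R}$ and $x\in\mathbb{R}$, $$\mathcal{G}_{\alpha,m}f(x)=\Big(\int_{\mathbb{R}}\Big|\frac{f(x+mt)-f(x)}{mt}-\frac{f(x+t)-f(x)}{t}\Big|^2\frac{dt}{|t|^{2\alpha-1}}\Big)^{1/2}\in[0,\infty],$$ $$S_\alpha f(x)=\Big(\iint_{\mathbb{R}\times\mathbb{R}}\Big|\frac{f(x+s)-f(x)}{s}-\frac{f(x+t)-f(x)}{t}\Big|^2\frac{ds\,dt}{|s-t|^{2\alpha}}\Big)^{1/2}\in[0,\infty].$$ *)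

theory Defs
  imports "HOL-Analysis.Analysis"
begin

text \<open>Square-integrable functions (as everywhere-defined representatives, not classes).\<close>

definition L2 :: "(real \<Rightarrow> complex) set" where
  "L2 = {f. f \<in> borel_measurable lebesgue \<and> integrable lebesgue (\<lambda>x. (cmod (f x))\<^sup>2)}"

text \<open>The square root on \<open>[0,\<infinity>]\<close>, with \<open>\<surd>\<infinity> = \<infinity>\<close>; the explicit case is needed because
  \<open>enn2real \<infinity> = 0\<close>.\<close>

definition ennreal_sqrt :: "ennreal \<Rightarrow> ennreal" where
  "ennreal_sqrt a = (if a = \<infinity> then \<infinity> else ennreal (sqrt (enn2real a)))"

text \<open>In both integrands the conventions \<open>z / 0 = 0\<close> and \<open>0 powr a = 0\<close> only matter on null sets
  (\<open>t = 0\<close>, respectively \<open>s = 0\<close>, \<open>t = 0\<close> or \<open>s = t\<close>), except in \<open>square_G\<close> for \<open>m = 0\<close>.\<close>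

definition square_G :: "real \<Rightarrow> real \<Rightarrow> (real \<Rightarrow> complex) \<Rightarrow> real \<Rightarrow> ennreal" where
  "square_G \<alpha> m f x = ennreal_sqrt
     (\<integral>\<^sup>+ t. ennreal
        ((cmod ((f (x + m * t) - f x) / of_real (m * t) - (f (x + t) - f x) / of_real t))\<^sup>2
          / \<bar>t\<bar> powr (2 * \<alpha> - 1)) \<partial>lebesgue)"

definition square_S :: "real \<Rightarrow> (real \<Rightarrow> complex) \<Rightarrow> real \<Rightarrow> ennreal" where
  "square_S \<alpha> f x = ennreal_sqrt
     (\<integral>\<^sup>+ (s, t). ennreal
        ((cmod ((f (x + s) - f x) / of_real s - (f (x + t) - f x) / of_real t))\<^sup>2
          / \<bar>s - t\<bar> powr (2 * \<alpha>)) \<partial>(lebesgue :: (real \<times> real) measure))"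

end

theory Submission
  imports Defs
begin

text \<open>Put \<open>g t = (f (x + t) - f x) / t\<close>. For \<open>u\<close> between \<open>1\<close> and \<open>m\<close> split
  \<open>g (m t) - g t = (g (m t) - g (t u)) + (g (t u) - g t)\<close> and average over \<open>u\<close>. The substitution
  \<open>s = t u\<close>, \<open>ds = |t| du\<close>, turns the weight \<open>|t|\<^sup>1\<^sup>-\<^sup>2\<^sup>\<alpha>\<close> into \<open>|t|\<^sup>-\<^sup>2\<^sup>\<alpha>\<close>. Both \<open>|t u - t|\<close> and
  \<open>|m t - t u|\<close> are at most \<open>(m - 1) |t|\<close>, so as \<open>\<alpha> \<ge> 0\<close> this weight is dominated by a multiple
  of the kernel of the double integral.\<close>

lemma norm_diff_square_le:
  fixes a b c :: "'a::real_normed_vector"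
  shows "(norm (a - b))\<^sup>2 \<le> 2 * (norm (a - c))\<^sup>2 + 2 * (norm (c - b))\<^sup>2"
proof -
  have "norm (a - b) \<le> norm (a - c) + norm (c - b)"
    using norm_triangle_ineq[of "a - c" "c - b"] by simp
  then have "(norm (a - b))\<^sup>2 \<le> (norm (a - c) + norm (c - b))\<^sup>2"
    by (simp add: power_mono)
  also have "\<dots> \<le> 2 * (norm (a - c))\<^sup>2 + 2 * (norm (c - b))\<^sup>2"
    using sum_squares_bound[of "norm (a - c)" "norm (c - b)"] by (simp add: power2_sum)
  finally show ?thesis .
qed

text \<open>Monotonicity of \<open>powr\<close> in the base for an exponent
  \<open>p \<ge> 0\<close>. It trades a weight in \<open>r\<close> for one in the smaller scale
  \<open>d\<close>; both are kept positive so that the conventions for \<open>0\<close> do not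
  interfere.\<close>

lemma divide_powr_le:
  fixes X d r c p :: real
  assumes "X \<ge> 0" "0 < d" "d \<le> c * r" "0 < r" "0 \<le> c" "0 \<le> p"
  shows "X / r powr p \<le> c powr p * (X / d powr p)"
proof -
  have "d powr p \<le> (c * r) powr p"
    using assms by (intro powr_mono2) auto
  also have "\<dots> = c powr p * r powr p"
    using assms by (simp add: powr_mult)
  finally have "X * d powr p \<le> X * (c powr p * r powr p)"
    using assms by (intro mult_left_mono) auto
  then show ?thesis
    using assms by (simp add: field_simps)
qed

text \<open>The comparison for one fixed \<open>u\<close>, before any integration. The factor
  \<open>\<bar>t\<bar>\<close> stays outside the kernels because it is the Jacobian of
  \<open>u \<mapsto> t * u\<close>.\<close>

lemma dilation_difference_le:
  fixes g :: "real \<Rightarrow> 'a::real_normed_vector"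
  assumes "\<alpha> \<ge> 0" "1 < u" "u < m" "t \<noteq> 0"
  shows "(norm (g (m * t) - g t))\<^sup>2 / \<bar>t\<bar> powr (2 * \<alpha> - 1)
    \<le> 2 * (m - 1) powr (2 * \<alpha>) * \<bar>t\<bar> *
        ((norm (g (t * u) - g t))\<^sup>2 / \<bar>t * u - t\<bar> powr (2 * \<alpha>) +
         (norm (g (m * t) - g (t * u)))\<^sup>2 / \<bar>m * t - t * u\<bar> powr (2 * \<alpha>))"
proof -
  let ?A = "(norm (g (t * u) - g t))\<^sup>2" and ?B = "(norm (g (m * t) - g (t * u)))\<^sup>2"
  have dA: "\<bar>t * u - t\<bar> = (u - 1) * \<bar>t\<bar>"
  proof -
    have "t * u - t = (u - 1) * t" by (simp add: algebra_simps)
    then show ?thesis using assms by (simp add: abs_mult)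
  qed
  have dB: "\<bar>m * t - t * u\<bar> = (m - u) * \<bar>t\<bar>"
  proof -
    have "m * t - t * u = (m - u) * t" by (simp add: algebra_simps)
    then show ?thesis using assms by (simp add: abs_mult)
  qed
  have A: "?A / \<bar>t\<bar> powr (2 * \<alpha>) \<le> (m - 1) powr (2 * \<alpha>) * (?A / \<bar>t * u - t\<bar> powr (2 * \<alpha>))"
    using assms unfolding dA by (intro divide_powr_le) auto
  have B: "?B / \<bar>t\<bar> powr (2 * \<alpha>) \<le> (m - 1) powr (2 * \<alpha>) * (?B / \<bar>m * t - t * u\<bar> powr (2 * \<alpha>))"
    using assms unfolding dB by (intro divide_powr_le) auto
  have "(norm (g (m * t) - g t))\<^sup>2 / \<bar>t\<bar> powr (2 * \<alpha> - 1)
      = \<bar>t\<bar> * ((norm (g (m * t) - g t))\<^sup>2 / \<bar>t\<bar> powr (2 * \<alpha>))"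
    using assms by (simp add: powr_diff)
  \<comment> \<open>The intermediate value \<open>g (t * u)\<close> is inserted between
    \<open>g (m * t)\<close> and \<open>g t\<close>.\<close>
  also have "\<dots> \<le> \<bar>t\<bar> * ((2 * ?B + 2 * ?A) / \<bar>t\<bar> powr (2 * \<alpha>))"
    by (intro mult_left_mono divide_right_mono norm_diff_square_le) auto
  also have "\<dots> = 2 * \<bar>t\<bar> * (?A / \<bar>t\<bar> powr (2 * \<alpha>) + ?B / \<bar>t\<bar> powr (2 * \<alpha>))"
    by (simp add: add_divide_distrib algebra_simps)
  also have "\<dots> \<le> 2 * \<bar>t\<bar> * ((m - 1) powr (2 * \<alpha>) * (?A / \<bar>t * u - t\<bar> powr (2 * \<alpha>)) +
      (m - 1) powr (2 * \<alpha>) * (?B / \<bar>m * t - t * u\<bar> powr (2 * \<alpha>)))"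
    by (intro mult_left_mono add_mono A B) auto
  finally show ?thesis
    by (simp add: algebra_simps)
qed

text \<open>The pointwise bound is integrated over \<open>u\<close> in \<open>(1, m)\<close> and
  then over \<open>t\<close>. In the constant, \<open>1 / (m - 1)\<close> comes from averaging over
  \<open>u\<close>, one factor 2 from squaring a sum of two terms, and the other from bounding both
  resulting double integrals by the same \<open>I\<close>. Borel measurability of \<open>g\<close>
  makes Tonelli available.\<close>

lemma nn_integral_dilation_difference_le:
  fixes g :: "real \<Rightarrow> 'a::{real_normed_vector, second_countable_topology}"
  assumes [measurable]: "g \<in> borel_measurable borel" and "\<alpha> \<ge> 0" "m > 1"
  shows "(\<integral>\<^sup>+ t. ennreal ((norm (g (m * t) - g t))\<^sup>2 / \<bar>t\<bar> powr (2 * \<alpha> - 1)) \<partial>lborel)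
    \<le> ennreal (4 * (m - 1) powr (2 * \<alpha>) / (m - 1)) *
      (\<integral>\<^sup>+ p. ennreal ((norm (g (fst p) - g (snd p)))\<^sup>2 / \<bar>fst p - snd p\<bar> powr (2 * \<alpha>))
        \<partial>(lborel :: (real \<times> real) measure))"
proof -
  define Q where "Q = (\<lambda>s t. ennreal ((norm (g s - g t))\<^sup>2 / \<bar>s - t\<bar> powr (2 * \<alpha>)))"
  define P where "P = (\<lambda>t. ennreal ((norm (g (m * t) - g t))\<^sup>2 / \<bar>t\<bar> powr (2 * \<alpha> - 1)))"
  define D where "D = 2 * (m - 1) powr (2 * \<alpha>)"
  define I where "I = (\<integral>\<^sup>+ p. Q (fst p) (snd p) \<partial>(lborel :: (real \<times> real) measure))"
  have D: "D \<ge> 0" by (simp add: D_def)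
  have Q_meas [measurable]: "case_prod Q \<in> borel_measurable (borel \<Otimes>\<^sub>M borel)"
    unfolding Q_def by measurable
  have [measurable]: "P \<in> borel_measurable borel"
    unfolding P_def by measurable
  have Q_lborel: "(\<lambda>p. Q (fst p) (snd p)) \<in> borel_measurable (lborel \<Otimes>\<^sub>M lborel)"
    by measurable
  have fst: "(\<integral>\<^sup>+ s. \<integral>\<^sup>+ t. Q s t \<partial>lborel \<partial>lborel) = I"
    using lborel.nn_integral_fst[OF Q_lborel] by (simp add: I_def lborel_prod)
  have snd: "(\<integral>\<^sup>+ t. \<integral>\<^sup>+ s. Q s t \<partial>lborel \<partial>lborel) = I"
    using lborel_pair.nn_integral_snd[OF Q_lborel] by (simp add: I_def lborel_prod)
  have inner: "ennreal (m - 1) * P t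
      \<le> ennreal D * ((\<integral>\<^sup>+ s. Q s t \<partial>lborel) + (\<integral>\<^sup>+ s. Q (m * t) s \<partial>lborel))" if "t \<noteq> 0" for t
  proof -
    have "ennreal (m - 1) * P t = (\<integral>\<^sup>+ u. P t * indicator {1<..<m} u \<partial>lborel)"
      using assms by (simp add: nn_integral_cmult_indicator mult.commute)
    \<comment> \<open>The bound is used only on \<open>(1, m)\<close>; the right side is
      nonnegative, so its integral may run over the whole line. The form \<open>0 + t * u\<close>
      prepares the affine substitution \<open>s = t * u\<close>, legitimate since
      \<open>t \<noteq> 0\<close>.\<close>
    also have "\<dots> \<le> (\<integral>\<^sup>+ u. ennreal D * (ennreal \<bar>t\<bar> * (Q (0 + t * u) t + Q (m * t) (0 + t * u))) \<partial>lborel)"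
    proof (intro nn_integral_mono)
      fix u :: real
      show "P t * indicator {1<..<m} u
        \<le> ennreal D * (ennreal \<bar>t\<bar> * (Q (0 + t * u) t + Q (m * t) (0 + t * u)))"
      proof (cases "u \<in> {1<..<m}")
        case True
        then have "P t \<le> ennreal (D * \<bar>t\<bar> *
            ((norm (g (t * u) - g t))\<^sup>2 / \<bar>t * u - t\<bar> powr (2 * \<alpha>) +
             (norm (g (m * t) - g (t * u)))\<^sup>2 / \<bar>m * t - t * u\<bar> powr (2 * \<alpha>)))"
          using dilation_difference_le[of \<alpha> u m t g] assms that
          unfolding P_def D_def by (intro ennreal_leI) auto
        with True show ?thesis
          using D by (simp add: Q_def ennreal_mult ennreal_plus mult.assoc flip: ennreal_plus)
      qed simp
    qed
    also have "\<dots> = ennreal D * (ennreal \<bar>t\<bar> * (\<integral>\<^sup>+ u. (Q (0 + t * u) t + Q (m * t) (0 + t * u)) \<partial>lborel))"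
      by (simp add: nn_integral_cmult)
    also have "\<dots> = ennreal D * (\<integral>\<^sup>+ s. (Q s t + Q (m * t) s) \<partial>lborel)"
      using nn_integral_real_affine[of "\<lambda>s. Q s t + Q (m * t) s" t 0] that by simp
    finally show ?thesis
      by (simp add: nn_integral_add)
  qed
  \<comment> \<open>Substituting \<open>m * t\<close> for \<open>t\<close> yields
    \<open>I / m\<close>; as \<open>m > 1\<close>, this gain is simply dropped.\<close>
  have scaled: "(\<integral>\<^sup>+ t. \<integral>\<^sup>+ s. Q (m * t) s \<partial>lborel \<partial>lborel) \<le> I"
  proof -
    have "1 * (\<integral>\<^sup>+ t. \<integral>\<^sup>+ s. Q (m * t) s \<partial>lborel \<partial>lborel)
        \<le> ennreal \<bar>m\<bar> * (\<integral>\<^sup>+ t. \<integral>\<^sup>+ s. Q (0 + m * t) s \<partial>lborel \<partial>lborel)"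
      using assms by (simp only: add_0) (intro mult_right_mono, auto)
    also have "\<dots> = (\<integral>\<^sup>+ t. \<integral>\<^sup>+ s. Q t s \<partial>lborel \<partial>lborel)"
      using assms by (intro nn_integral_real_affine[symmetric]) auto
    finally show ?thesis using fst by simp
  qed
  have "ennreal (m - 1) * (\<integral>\<^sup>+ t. P t \<partial>lborel) = (\<integral>\<^sup>+ t. ennreal (m - 1) * P t \<partial>lborel)"
    by (simp add: nn_integral_cmult)
  also have "\<dots> \<le> (\<integral>\<^sup>+ t. ennreal D *
      ((\<integral>\<^sup>+ s. Q s t \<partial>lborel) + (\<integral>\<^sup>+ s. Q (m * t) s \<partial>lborel)) \<partial>lborel)"
    using AE_lborel_singleton[of "0::real"] inner by (intro nn_integral_mono_AE) auto
  also have "\<dots> = ennreal D * (I + (\<integral>\<^sup>+ t. \<integral>\<^sup>+ s. Q (m * t) s \<partial>lborel \<partial>lborel))"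
    by (simp add: nn_integral_cmult nn_integral_add snd)
  also have "\<dots> \<le> ennreal D * (I + I)"
    by (intro mult_left_mono add_left_mono scaled) auto
  also have "\<dots> = ennreal (2 * D) * I"
    using D by (simp add: ennreal_mult mult.assoc mult.left_commute flip: mult_2)
  finally have *: "ennreal (m - 1) * (\<integral>\<^sup>+ t. P t \<partial>lborel) \<le> ennreal (2 * D) * I" .
  \<comment> \<open>The integral may be infinite, so \<open>m - 1\<close> is removed by multiplying
    with its finite inverse.\<close>
  have "(\<integral>\<^sup>+ t. P t \<partial>lborel) = ennreal (1 / (m - 1)) * (ennreal (m - 1) * (\<integral>\<^sup>+ t. P t \<partial>lborel))"
    using assms by (simp flip: mult.assoc ennreal_mult)
  also have "\<dots> \<le> ennreal (1 / (m - 1)) * (ennreal (2 * D) * I)"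
    by (intro mult_left_mono *) auto
  also have "\<dots> = ennreal (4 * (m - 1) powr (2 * \<alpha>) / (m - 1)) * I"
    using assms D by (simp add: D_def flip: mult.assoc ennreal_mult)
  finally show ?thesis
    by (simp add: P_def Q_def I_def)
qed

lemma completion_ex_borel_measurable_complex:
  fixes f :: "'a \<Rightarrow> complex"
  assumes "f \<in> borel_measurable (completion M)"
  obtains h where "h \<in> borel_measurable M" "AE x in M. f x = h x"
proof -
  have "(\<lambda>x. Re (f x)) \<in> borel_measurable (completion M)"
    "(\<lambda>x. Im (f x)) \<in> borel_measurable (completion M)"
    using assms by measurable
  then obtain a b where [measurable]: "a \<in> borel_measurable M" "b \<in> borel_measurable M"
    and ab: "AE x in M. Re (f x) = a x" "AE x in M. Im (f x) = b x"
    by (blast dest: completion_ex_borel_measurable_real)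
  show thesis
  proof
    show "(\<lambda>x. Complex (a x) (b x)) \<in> borel_measurable M"
      unfolding Complex_eq by measurable
    show "AE x in M. f x = Complex (a x) (b x)"
      using ab by eventually_elim (simp add: complex_eq_iff)
  qed
qed

text \<open>\<open>P\<close> itself may be non-measurable, so the exceptional set is first enclosed
  in a Borel null set, and nonsingular affine maps pull such sets back to null sets.\<close>

lemma AE_lborel_affine:
  fixes P :: "real \<Rightarrow> bool"
  assumes "AE x in lborel. P x" "c \<noteq> 0"
  shows "AE x in lborel. P (t + c * x)"
proof -
  obtain N where N: "N \<in> null_sets lborel" "{x. \<not> P x} \<subseteq> N"
    using assms(1) by (auto simp: eventually_ae_filter)
  then have [measurable]: "N \<in> sets borel" by auto
  have "AE x in lborel. x \<notin> N" using N(1) by (rule AE_not_in)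
  then have "AE x in lborel. t + c * x \<notin> N"
    using AE_borel_affine[of c "\<lambda>x. x \<notin> N" t] assms(2) by simp
  then show ?thesis by eventually_elim (use N(2) in auto)
qed

text \<open>With the exceptional set inside a Borel null set \<open>N\<close>, the strips over
  \<open>N\<close> in both directions are null in the plane by Fubini.\<close>

lemma AE_lborel_prod:
  fixes P :: "real \<Rightarrow> bool"
  assumes "AE x in lborel. P x"
  shows "AE p in (lborel :: (real \<times> real) measure). P (fst p) \<and> P (snd p)"
proof -
  obtain N where N: "N \<in> null_sets lborel" "{x. \<not> P x} \<subseteq> N"
    using assms by (auto simp: eventually_ae_filter)
  then have [measurable]: "N \<in> sets borel" by auto
  have ae: "AE x in lborel. x \<notin> N" using N(1) by (rule AE_not_in)
  have "AE p in lborel \<Otimes>\<^sub>M lborel. fst p \<notin> N \<and> snd p \<notin> N"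
  proof (rule lborel_pair.AE_pair_measure)
    show "{p \<in> space (lborel \<Otimes>\<^sub>M lborel). fst p \<notin> N \<and> snd p \<notin> N} \<in> sets (lborel \<Otimes>\<^sub>M lborel)"
      by measurable
    show "AE x in lborel. AE y in lborel. fst (x, y) \<notin> N \<and> snd (x, y) \<notin> N"
      using ae by eventually_elim (use ae in auto)
  qed
  then show ?thesis
    unfolding lborel_prod by eventually_elim (use N(2) in auto)
qed

text \<open>If \<open>b\<close> is infinite, \<open>K > 0\<close> makes the right side infinite.
  Otherwise \<open>a\<close> is finite too and the claim is one about real square roots.\<close>

lemma ennreal_sqrt_le:
  assumes "a \<le> ennreal K * b" "K > 0"
  shows "ennreal_sqrt a \<le> ennreal (sqrt K) * ennreal_sqrt b"
proof (cases "b = \<infinity>")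
  case True
  then show ?thesis using assms(2) by (simp add: ennreal_sqrt_def ennreal_mult_top)
next
  case False
  then obtain y where y: "y \<ge> 0" "b = ennreal y" by (cases b) auto
  with assms have a: "a \<le> ennreal (K * y)" by (simp add: ennreal_mult)
  then obtain x where x: "x \<ge> 0" "a = ennreal x" by (cases a) (auto simp: top_unique)
  from a x y assms(2) have "x \<le> K * y" by simp
  then have "sqrt x \<le> sqrt K * sqrt y" by (simp flip: real_sqrt_mult)
  with x y assms(2) show ?thesis by (simp add: ennreal_sqrt_def flip: ennreal_mult)
qed

text \<open>For fixed \<open>x\<close>, both integrals see \<open>f (x + t)\<close> only up to null
  sets of \<open>t\<close>, so \<open>f\<close> may be replaced there by a Borel function, and
  Lebesgue measure by its Borel restriction.\<close>

lemma square_G_le_square_S: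
  assumes f: "f \<in> borel_measurable lebesgue" and "\<alpha> \<ge> 0" "m > 1"
  shows "square_G \<alpha> m f x \<le> ennreal (sqrt (4 * (m - 1) powr (2 * \<alpha>) / (m - 1))) * square_S \<alpha> f x"
proof -
  obtain h where h: "h \<in> borel_measurable borel" and fh: "AE t in lborel. f t = h t"
    using completion_ex_borel_measurable_complex[OF f] by auto
  note [measurable] = h
  \<comment> \<open>The value \<open>f x\<close> is kept rather than replaced by \<open>h x\<close>:
    the two functions agree only almost everywhere, while the estimate is claimed at every
    \<open>x\<close>.\<close>
  define g where "g = (\<lambda>t. (h (x + t) - f x) / of_real t)"
  have g_meas: "g \<in> borel_measurable borel"
    unfolding g_def by measurable
  have g: "AE t in lborel. (f (x + t) - f x) / of_real t = g t"
    using AE_lborel_affine[OF fh, of 1 x] by (auto simp: g_def elim!: eventually_mono)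
  have gm: "AE t in lborel. (f (x + m * t) - f x) / of_real (m * t) = g (m * t)"
    using AE_lborel_affine[OF g, of m 0] assms by simp
  have G: "(\<integral>\<^sup>+ t. ennreal
        ((cmod ((f (x + m * t) - f x) / of_real (m * t) - (f (x + t) - f x) / of_real t))\<^sup>2
          / \<bar>t\<bar> powr (2 * \<alpha> - 1)) \<partial>lebesgue)
      = (\<integral>\<^sup>+ t. ennreal ((cmod (g (m * t) - g t))\<^sup>2 / \<bar>t\<bar> powr (2 * \<alpha> - 1)) \<partial>lborel)"
    unfolding nn_integral_completion
    by (rule nn_integral_cong_AE) (use g gm in eventually_elim, simp only:)
  have S: "(\<integral>\<^sup>+ (s, t). ennreal
        ((cmod ((f (x + s) - f x) / of_real s - (f (x + t) - f x) / of_real t))\<^sup>2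
          / \<bar>s - t\<bar> powr (2 * \<alpha>)) \<partial>(lebesgue :: (real \<times> real) measure))
      = (\<integral>\<^sup>+ p. ennreal ((cmod (g (fst p) - g (snd p)))\<^sup>2 / \<bar>fst p - snd p\<bar> powr (2 * \<alpha>))
          \<partial>(lborel :: (real \<times> real) measure))"
    unfolding nn_integral_completion
    by (rule nn_integral_cong_AE) (use AE_lborel_prod[OF g] in eventually_elim, simp add: case_prod_beta)
  show ?thesis
    unfolding square_G_def square_S_def G S
    using assms by (intro ennreal_sqrt_le nn_integral_dilation_difference_le g_meas) auto
qed

theorem lemma3p1:
  fixes \<alpha> :: real
  assumes "\<alpha> \<ge> 0"
  shows "\<forall>m::real. m > 1 \<longrightarrow>
    (\<exists>C::real. C \<ge> 0 \<and>
      (\<forall>f \<in> L2. \<forall>x. square_G \<alpha> m f x \<le> ennreal C * square_S \<alpha> f x))"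
proof (intro allI impI)
  fix m :: real
  assume m: "m > 1"
  show "\<exists>C::real. C \<ge> 0 \<and>
      (\<forall>f \<in> L2. \<forall>x. square_G \<alpha> m f x \<le> ennreal C * square_S \<alpha> f x)"
  proof (intro exI conjI ballI allI)
    show "sqrt (4 * (m - 1) powr (2 * \<alpha>) / (m - 1)) \<ge> 0" using m by simp
    fix f x
    assume "f \<in> L2"
    then show "square_G \<alpha> m f x
        \<le> ennreal (sqrt (4 * (m - 1) powr (2 * \<alpha>) / (m - 1))) * square_S \<alpha> f x"
      using square_G_le_square_S assms m by (simp add: L2_def)
  qed
qed

end
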